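(* For a nonnegative integer $n$, define the Apéry polynomial $A_n(x)=\sum_{k=0}^{n}\binom{n}{k}^2\binom{n+k}{k}^2x^k$, and write $A_n=A_n(1)$. Let $x\in\mathbb{Z}$. (i) For every positive integer $n$, $$\sum_{k=0}^{n-1}(-1)^k(2k+1)A_k(x)\equiv 0\pmod n.$$ (ii) For every odd prime $p$, $$\frac{1}{p}\sum_{k=0}^{p-1}(-1)^k(2k+1)A_k(x)\equiv\left(\frac{1-4x}{p}\right)\pmod p,$$ where $\left(\frac{\cdot}{p}\right)$ is the Legendre symbol. (iii) For every prime $p>3$, $$\frac{1}{p}\sum_{k=0}^{p-1}(-1)^k(2k+1)A_k\equiv\left(\frac{p}{3}\right)\pmod{p^2},$$ and $$\frac{1}{p}\sum_{k=0}^{p-1}(-1)^k(2k+1)A_k(-2)\equiv 1-\frac{4}{3}\left(2^{p-1}-1\right)\pmod{p^2}.$$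
   Context: Congruences between rationals whose denominators are prime to the modulus are understood in the usual way (e.g. $\frac{4}{3}$ modulo $p^2$ for $p>3$). $\left(\frac{a}{p}\right)$ denotes the Legendre symbol modulo $p$, and $\left(\frac{p}{3}\right)$ the Legendre symbol modulo $3$. *)

theory Defs
  imports "HOL-Number_Theory.Number_Theory" "HOL-Computational_Algebra.Polynomial"
begin

definition apery_poly :: "nat \<Rightarrow> int poly" where
  "apery_poly n = (\<Sum>k\<le>n. monom (int ((n choose k)\<^sup>2 * ((n + k) choose k)\<^sup>2)) k)"

definition apery :: "nat \<Rightarrow> int" where
  "apery n = poly (apery_poly n) 1"

text \<open>
  Congruence of rationals modulo an integer. Since \<open>quotient_of\<close> returns numerator
  and denominator in lowest terms, both rationals are required to have denominators prime
  to the modulus, and the modulus must divide the numerator of their difference.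
\<close>

definition rat_cong :: "rat \<Rightarrow> rat \<Rightarrow> int \<Rightarrow> bool" where
  "rat_cong a b m \<longleftrightarrow>
     coprime (snd (quotient_of a)) m \<and> coprime (snd (quotient_of b)) m \<and>
     m dvd fst (quotient_of (a - b))"

end

theory Submission
  imports Defs "HOL-Computational_Algebra.Formal_Power_Series"
begin

text \<open>
  Write \<open>b n k = apery_binomial n k = (n choose k) * (n + k choose k)\<close>. The linearization
  \<open>(b n k)\<^sup>2 = (2k choose k) * (\<Sum>j\<le>k. b k j * b n (k + j))\<close> and the telescoping sum
  \<open>(\<Sum>k<n. (-1)^k * (2k + 1) * b k m) = (-1)^(n-1) * n * (n - 1 choose m) * (n + m choose m)\<close>
  make the sum of the theorem an explicit multiple of \<open>n\<close>. For \<open>n = p\<close> an odd prime,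
  \<open>(p - 1 choose m) * (p + m choose m) \<equiv> (-1)^m\<close> modulo \<open>p\<^sup>2\<close>, and the quotient collapses to
  \<open>\<Sum>k<p. (2k choose k) * x^k\<close> modulo \<open>p\<^sup>2\<close>. Modulo \<open>p\<close> this is \<open>(1 - 4x)^((p-1)/2)\<close>.
  For \<open>x = 1\<close> and \<open>x = -2\<close> it is a sum of the \<open>(2p choose p + j)\<close> weighted by a second-order
  recurrence, where \<open>(2p choose p + j) \<equiv> 2 * (p choose j)\<close> modulo \<open>p\<^sup>2\<close> reduces everything
  to the binomial theorem.
\<close>

section \<open>Products of two binomials and their linearization\<close>

text \<open>Up to the sign \<open>(-1)^k\<close> these are the coefficients of the shifted Legendre
  polynomial.\<close>

definition apery_binomial :: "nat \<Rightarrow> nat \<Rightarrow> int" where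
  "apery_binomial n k = int (n choose k) * int ((n + k) choose k)"

lemma apery_binomial_0 [simp]: "apery_binomial n 0 = 1"
  by (simp add: apery_binomial_def)

lemma apery_binomial_eq_0 [simp]: "n < k \<Longrightarrow> apery_binomial n k = 0"
  by (simp add: apery_binomial_def)

text \<open>The absorption identities are taken over \<open>int\<close>, where subtraction is not
  truncated, so that they hold for all \<open>n\<close> and \<open>k\<close>.\<close>

lemma int_binomial_Suc_right:
  "(int k + 1) * int (n choose Suc k) = (int n - int k) * int (n choose k)"
proof (cases "k \<le> n")
  case True
  have "Suc k * (n choose Suc k) = (n - k) * (n choose k)"
    by (simp only: binomial_absorption binomial_absorb_comp)
  then have "int (Suc k * (n choose Suc k)) = int ((n - k) * (n choose k))" by (simp only:)
  with True show ?thesis by (simp add: algebra_simps)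
qed (simp add: binomial_eq_0)

lemma int_binomial_Suc_both:
  "(int k + 1) * int (Suc n choose Suc k) = (int n + 1) * int (n choose k)"
  using Suc_times_binomial[of k n] by (metis of_nat_Suc of_nat_mult add.commute)

lemma int_binomial_Suc_left:
  "(int n + 1 - int k) * int (Suc n choose k) = (int n + 1) * int (n choose k)"
proof (cases k)
  case (Suc j)
  have "(int n - int j) * int (Suc n choose Suc j)
      = (int n - int j) * int (n choose j) + (int n - int j) * int (n choose Suc j)"
    by (simp add: algebra_simps)
  also have "\<dots> = (int n + 1) * int (n choose Suc j)"
    using int_binomial_Suc_right[of j n] by (simp add: algebra_simps)
  finally show ?thesis using Suc by simp
qed simp

text \<open>The factor on the right is \<open>n * (n + 1) - k * (k + 1)\<close>. Later inductions
  multiply by the square on the left and cancel it at the end.\<close>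

lemma apery_binomial_Suc:
  "(int k + 1)\<^sup>2 * apery_binomial n (Suc k) = (int n - int k) * (int n + int k + 1) * apery_binomial n k"
proof -
  have "(int k + 1)\<^sup>2 * apery_binomial n (Suc k)
    = ((int k + 1) * int (n choose Suc k)) * ((int k + 1) * int (Suc (n + k) choose Suc k))"
    by (simp add: apery_binomial_def power2_eq_square)
  also have "\<dots> = ((int n - int k) * int (n choose k)) * ((int (n + k) + 1) * int ((n + k) choose k))"
    unfolding int_binomial_Suc_both by (simp only: int_binomial_Suc_right)
  finally show ?thesis by (simp add: apery_binomial_def)
qed

text \<open>
  With \<open>X = n * (n + 1)\<close> one has \<open>b n k = (\<Prod>i<k. X - i * (i + 1)) / (k!)\<^sup>2\<close>, so the step from \<open>r\<close> to
  \<open>r + 1\<close> multiplies by \<open>X - r * (r + 1)\<close>, split as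
  \<open>(X - m * (m + 1)) + (m * (m + 1) - r * (r + 1))\<close> in the term with \<open>m = k + j\<close>.
\<close>
lemma apery_binomial_mult:
  "apery_binomial n r * apery_binomial n k =
    int ((k + r) choose r) *
      (\<Sum>j\<le>r. int (r choose j) * int ((k + j) choose r) * apery_binomial n (k + j))"
proof (induction r)
  case (Suc r)
  define b where "b j = apery_binomial n (k + j)" for j
  define C where "C = int ((k + r) choose r)"
  define f where "f j = int (r choose j) * int ((k + j) choose r)" for j
  \<comment> \<open>By \<open>u1\<close> and \<open>u2\<close>, both halves of the split produce the
    same weight \<open>u\<close>, once at \<open>Suc j\<close> and once at \<open>j\<close>, so they
    combine after a shift of the index.\<close>
  define u where "u j = (int k + int j - int r) * int ((k + j) choose r)" for j
  have b_Suc: "(int n - int r) * (int n + int r + 1) * b j =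
      (int (k + j) + 1)\<^sup>2 * b (Suc j) + (int (k + j) - int r) * (int (k + j) + int r + 1) * b j" for j
  proof -
    have "(int n - int r) * (int n + int r + 1) =
      (int n - int (k + j)) * (int n + int (k + j) + 1) + (int (k + j) - int r) * (int (k + j) + int r + 1)"
      by (simp add: algebra_simps)
    then show ?thesis
      using apery_binomial_Suc[of "k + j" n] unfolding b_def
      by (simp add: distrib_right)
  qed
  have C_Suc: "(int r + 1) * int ((k + Suc r) choose Suc r) = (int k + int r + 1) * C"
    using int_binomial_Suc_both[of r "k + r"] by (simp add: C_def del: binomial_Suc_Suc)
  have u1: "(int r + 1) * int ((k + j) choose Suc r) = u j" for j
    using int_binomial_Suc_right[of r "k + j"] by (simp add: u_def)
  have u2: "(int (k + j) + 1) * int ((k + j) choose r) = u (Suc j)" for j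
    using int_binomial_Suc_left[of "k + j" r] by (simp add: u_def algebra_simps)
  have "(int r + 1)\<^sup>2 * (apery_binomial n (Suc r) * apery_binomial n k) =
      ((int n - int r) * (int n + int r + 1)) * (apery_binomial n r * apery_binomial n k)"
    using apery_binomial_Suc[of r n] by (simp add: mult.assoc[symmetric])
  also have "\<dots> = C * (\<Sum>j\<le>r. f j * ((int n - int r) * (int n + int r + 1) * b j))"
    unfolding Suc.IH b_def C_def f_def by (simp add: sum_distrib_left mult_ac)
  also have "(\<Sum>j\<le>r. f j * ((int n - int r) * (int n + int r + 1) * b j)) =
      (\<Sum>j\<le>r. int (r choose j) * (int (k + j) + 1) * u (Suc j) * b (Suc j)) +
      (\<Sum>j\<le>r. int (r choose j) * (int (k + j) + int r + 1) * u j * b j)"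
    unfolding b_Suc sum.distrib[symmetric]
  proof (rule sum.cong)
    fix j
    have "u j = (int (k + j) - int r) * int ((k + j) choose r)" by (simp add: u_def)
    then show "f j * ((int (k + j) + 1)\<^sup>2 * b (Suc j) + (int (k + j) - int r) * (int (k + j) + int r + 1) * b j)
      = int (r choose j) * (int (k + j) + 1) * u (Suc j) * b (Suc j) +
        int (r choose j) * (int (k + j) + int r + 1) * u j * b j"
      by (simp add: f_def u2[symmetric] power2_eq_square ring_distribs mult_ac del: of_nat_add)
  qed simp
  also have "(\<Sum>j\<le>r. int (r choose j) * (int (k + j) + 1) * u (Suc j) * b (Suc j)) =
      (\<Sum>j\<in>{1..Suc r}. int (r choose (j - 1)) * int (k + j) * u j * b j)"
    by (rule sum.reindex_bij_witness[of _ "\<lambda>j. j - 1" Suc]) auto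
  \<comment> \<open>At \<open>j = 0\<close> truncated subtraction would turn
    \<open>r choose (j - 1)\<close> into 1, hence the explicit value 0.\<close>
  also have "\<dots> = (\<Sum>j\<le>Suc r. (if j = 0 then 0 else int (r choose (j - 1))) * int (k + j) * u j * b j)"
    by (rule sum.mono_neutral_cong_left) auto
  also have "(\<Sum>j\<le>r. int (r choose j) * (int (k + j) + int r + 1) * u j * b j) =
      (\<Sum>j\<le>Suc r. int (r choose j) * (int (k + j) + int r + 1) * u j * b j)"
    by simp
  also have "(\<Sum>j\<le>Suc r. (if j = 0 then 0 else int (r choose (j - 1))) * int (k + j) * u j * b j)
      + (\<Sum>j\<le>Suc r. int (r choose j) * (int (k + j) + int r + 1) * u j * b j)
      = (\<Sum>j\<le>Suc r. (int k + int r + 1) * int (Suc r choose j) * u j * b j)"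
    unfolding sum.distrib[symmetric]
  proof (rule sum.cong)
    fix j
    \<comment> \<open>A weighted Pascal rule: beyond Pascal it needs only
      \<open>j * (r choose j) = (r + 1 - j) * (r choose (j - 1))\<close>.\<close>
    have "(if j = 0 then 0 else int (r choose (j - 1))) * int (k + j)
        + int (r choose j) * (int (k + j) + int r + 1) = (int k + int r + 1) * int (Suc r choose j)"
    proof (cases j)
      case (Suc i)
      then show ?thesis
        using int_binomial_Suc_right[of i r] by (simp add: algebra_simps)
    qed (simp add: algebra_simps)
    from arg_cong[OF this, of "\<lambda>z. z * (u j * b j)"]
    show "(if j = 0 then 0 else int (r choose (j - 1))) * int (k + j) * u j * b j
        + int (r choose j) * (int (k + j) + int r + 1) * u j * b j
        = (int k + int r + 1) * int (Suc r choose j) * u j * b j"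
      by (simp only: algebra_simps)
  qed simp
  also have "C * \<dots> = ((int r + 1) * int ((k + Suc r) choose Suc r)) *
      (\<Sum>j\<le>Suc r. int (Suc r choose j) * ((int r + 1) * int ((k + j) choose Suc r)) * b j)"
    unfolding C_Suc unfolding u1 by (simp only: sum_distrib_left mult_ac)
  also have "\<dots> = (int r + 1)\<^sup>2 * (int ((k + Suc r) choose Suc r) *
      (\<Sum>j\<le>Suc r. int (Suc r choose j) * int ((k + j) choose Suc r) * b j))"
    by (simp only: sum_distrib_left power2_eq_square mult_ac)
  finally have "(int r + 1)\<^sup>2 * (apery_binomial n (Suc r) * apery_binomial n k) = \<dots>" .
  moreover have "(int r + 1)\<^sup>2 \<noteq> 0" by simp
  ultimately show ?case unfolding b_def using mult_left_cancel by blast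
qed simp

section \<open>The alternating sum as an explicit multiple of \<open>n\<close>\<close>

text \<open>One bound \<open>N\<close> for all \<open>k\<close> lets the sums over \<open>k\<close>
  and \<open>i\<close> be interchanged; the added terms vanish.\<close>

lemma poly_apery_poly:
  assumes "k \<le> N"
  shows "poly (apery_poly k) x = (\<Sum>i\<le>N. (apery_binomial k i)\<^sup>2 * x ^ i)"
proof -
  have "poly (apery_poly k) x = (\<Sum>i\<le>k. (apery_binomial k i)\<^sup>2 * x ^ i)"
    by (simp add: apery_poly_def poly_sum poly_monom apery_binomial_def power_mult_distrib)
  also have "\<dots> = (\<Sum>i\<le>N. (apery_binomial k i)\<^sup>2 * x ^ i)"
    using assms by (intro sum.mono_neutral_left) auto
  finally show ?thesis .
qed

text \<open>The closed forms at \<open>n\<close> and \<open>n + 1\<close> are, up to sign,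
  \<open>n - m\<close> and \<open>n + m + 1\<close> times \<open>apery_binomial n m\<close>
  (\<open>e2\<close> and \<open>e1\<close>), and these factors add up to
  \<open>2 * n + 1\<close>.\<close>

lemma sum_apery_binomial:
  "(\<Sum>k<n. (-1) ^ k * (2 * int k + 1) * apery_binomial k m) =
    - ((-1) ^ n * int n * (int ((n - 1) choose m) * int ((n + m) choose m)))"
proof (induction n)
  case (Suc n)
  have 1: "(int n + 1) * int ((Suc n + m) choose m) = (int n + int m + 1) * int ((n + m) choose m)"
    using int_binomial_Suc_left[of "n + m" m] by (simp add: algebra_simps)
  have 2: "int n * int ((n - 1) choose m) = (int n - int m) * int (n choose m)"
    using int_binomial_Suc_left[of "n - 1" m]
    by (cases n) (auto simp: add.commute simp del: binomial_Suc_Suc)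
  have e1: "(int n + 1) * (int (n choose m) * int ((Suc n + m) choose m)) =
      (int n + int m + 1) * apery_binomial n m"
    using arg_cong[OF 1, of "\<lambda>z. int (n choose m) * z"] by (simp add: apery_binomial_def mult_ac)
  have e2: "int n * (int ((n - 1) choose m) * int ((n + m) choose m)) =
      (int n - int m) * apery_binomial n m"
    using arg_cong[OF 2, of "\<lambda>z. z * int ((n + m) choose m)"] by (simp add: apery_binomial_def mult_ac)
  have "(\<Sum>k<Suc n. (-1) ^ k * (2 * int k + 1) * apery_binomial k m) =
     (-1) ^ n * ((2 * int n + 1) * apery_binomial n m - (int n - int m) * apery_binomial n m)"
    unfolding sum.lessThan_Suc Suc.IH e2[symmetric] by (simp add: algebra_simps)
  also have "\<dots> = (-1) ^ n * ((int n + int m + 1) * apery_binomial n m)"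
    by (simp add: algebra_simps)
  finally show ?case unfolding e1[symmetric] by simp
qed simp

text \<open>The cofactor of \<open>n\<close> that remains once the squares are linearized and the
  sum over \<open>k\<close> is evaluated; it is an integer by construction.\<close>

definition apery_quot :: "nat \<Rightarrow> int \<Rightarrow> int" where
  "apery_quot n x = - ((-1) ^ n) * (\<Sum>i<n. int ((2 * i) choose i) * x ^ i *
     (\<Sum>j\<le>i. apery_binomial i j * (int ((n - 1) choose (i + j)) * int ((n + (i + j)) choose (i + j)))))"

lemma sum_apery_poly:
  "(\<Sum>k<n. (-1) ^ k * (2 * int k + 1) * poly (apery_poly k) x) = int n * apery_quot n x"
proof -
  \<comment> \<open>The diagonal case of \<open>apery_binomial_mult\<close>, with
    \<open>(i + j) choose i\<close> rewritten by symmetry. Each summand becomes linear in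
    \<open>apery_binomial k (i + j)\<close>, so the sum over \<open>k\<close> telescopes.\<close>
  have sq: "(apery_binomial k i)\<^sup>2 =
      int ((2 * i) choose i) * (\<Sum>j\<le>i. apery_binomial i j * apery_binomial k (i + j))" for k i
  proof -
    have "int (i choose j) * int ((i + j) choose i) = apery_binomial i j" for j
      using binomial_symmetric[of i "i + j"] unfolding apery_binomial_def
      by (metis add_diff_cancel_left' le_add1)
    then show ?thesis
      using apery_binomial_mult[of k i i] by (simp only: power2_eq_square mult_2)
  qed
  have "(\<Sum>k<n. (-1) ^ k * (2 * int k + 1) * poly (apery_poly k) x) =
    (\<Sum>k<n. (-1) ^ k * (2 * int k + 1) * (\<Sum>i<n. (apery_binomial k i)\<^sup>2 * x ^ i))"
  proof (rule sum.cong)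
    fix k assume "k \<in> {..<n}"
    then have "poly (apery_poly k) x = (\<Sum>i\<le>n - 1. (apery_binomial k i)\<^sup>2 * x ^ i)"
      by (intro poly_apery_poly) auto
    moreover from \<open>k \<in> {..<n}\<close> have "{..n - 1} = {..<n}" by auto
    ultimately show "(-1) ^ k * (2 * int k + 1) * poly (apery_poly k) x =
      (-1) ^ k * (2 * int k + 1) * (\<Sum>i<n. (apery_binomial k i)\<^sup>2 * x ^ i)" by simp
  qed simp
  also have "\<dots> = (\<Sum>k<n. \<Sum>i<n. \<Sum>j\<le>i. int ((2 * i) choose i) * x ^ i * (apery_binomial i j *
      ((-1) ^ k * (2 * int k + 1) * apery_binomial k (i + j))))"
    unfolding sq by (simp only: sum_distrib_left sum_distrib_right mult_ac)
  also have "\<dots> = (\<Sum>i<n. \<Sum>j\<le>i. \<Sum>k<n. int ((2 * i) choose i) * x ^ i * (apery_binomial i j *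
      ((-1) ^ k * (2 * int k + 1) * apery_binomial k (i + j))))"
    by (subst sum.swap, rule sum.cong[OF refl], subst sum.swap, rule refl)
  also have "\<dots> = (\<Sum>i<n. int ((2 * i) choose i) * x ^ i * (\<Sum>j\<le>i. apery_binomial i j *
      (\<Sum>k<n. (-1) ^ k * (2 * int k + 1) * apery_binomial k (i + j))))"
    by (simp only: sum_distrib_left)
  also have "\<dots> = int n * apery_quot n x"
    unfolding sum_apery_binomial apery_quot_def
    by (simp add: sum_distrib_left sum_negf mult_ac)
  finally show ?thesis .
qed

text \<open>Vandermonde's convolution with upper indices \<open>- n - 1\<close> and \<open>n\<close>.\<close>
lemma alternating_sum_apery_binomial: "(\<Sum>j\<le>n. (-1) ^ j * apery_binomial n j) = (-1) ^ n"
proof -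
  \<comment> \<open>Negating the upper index absorbs the alternating sign; the two upper indices
    then add up to -1.\<close>
  have 1: "(- (real n + 1)) gchoose j = (-1) ^ j * real ((n + j) choose j)" for j
    using gbinomial_minus[of "real n + 1" j] by (simp add: binomial_gbinomial add.commute del: minus_add_distrib)
  have "(\<Sum>j=0..n. ((- (real n + 1)) gchoose j) * (real n gchoose (n - j))) = (- (real n + 1) + real n) gchoose n"
    by (rule gbinomial_Vandermonde)
  also have "\<dots> = (-1) ^ n"
    using gbinomial_minus[of 1 n] by (simp add: binomial_gbinomial[symmetric])
  also have "(\<Sum>j=0..n. ((- (real n + 1)) gchoose j) * (real n gchoose (n - j))) =
      real_of_int (\<Sum>j\<le>n. (-1) ^ j * apery_binomial n j)"
    unfolding of_int_sum
  proof (rule sum.cong)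
    fix j assume "j \<in> {..n}"
    then have "real (n choose (n - j)) = real (n choose j)"
      using binomial_symmetric[of j n] by simp
    then show "((- (real n + 1)) gchoose j) * (real n gchoose (n - j)) =
        real_of_int ((-1) ^ j * apery_binomial n j)"
      by (simp add: 1 apery_binomial_def binomial_gbinomial[symmetric] del: minus_add_distrib)
  qed (auto simp: atLeast0AtMost)
  finally have "real_of_int (\<Sum>j\<le>n. (-1) ^ j * apery_binomial n j) = real_of_int ((-1) ^ n)" by simp
  then show ?thesis by (simp only: of_int_eq_iff)
qed

section \<open>Reduction of the quotient modulo \<open>p^2\<close>\<close>

lemma coprime_int_prime:
  assumes "prime p" "0 < k" "k < p"
  shows "coprime (int k) (int p)"
proof -
  have "\<not> p dvd k" using assms by (auto dest: dvd_imp_le)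
  then show ?thesis using prime_imp_coprime[OF assms(1)] by (simp add: coprime_commute)
qed

text \<open>Passing from \<open>m\<close> to \<open>m + 1\<close> multiplies the product by
  \<open>(p^2 - (m + 1)^2) / (m + 1)^2\<close>. The terms linear in \<open>p\<close> cancel, so each
  factor is -1 modulo \<open>p^2\<close>.\<close>

lemma cong_choose_prime_mult:
  assumes "prime p" "m < p"
  shows "[int ((p - 1) choose m) * int ((p + m) choose m) = (-1) ^ m] (mod (int p)\<^sup>2)"
  using \<open>m < p\<close>
proof (induction m)
  case (Suc m)
  have p: "int (p - 1) = int p - 1" using Suc.prems by simp
  have cop: "coprime ((int m + 1)\<^sup>2) ((int p)\<^sup>2)"
    using coprime_int_prime[OF \<open>prime p\<close>, of "Suc m"] Suc.prems by (simp add: add.commute)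
  have "(int m + 1)\<^sup>2 * (int ((p - 1) choose Suc m) * int ((p + Suc m) choose Suc m)) =
      ((int m + 1) * int ((p - 1) choose Suc m)) * ((int m + 1) * int (Suc (p + m) choose Suc m))"
    by (simp only: power2_eq_square add_Suc_right mult_ac)
  also have "\<dots> = ((int p - 1 - int m) * int ((p - 1) choose m)) * ((int (p + m) + 1) * int ((p + m) choose m))"
    unfolding int_binomial_Suc_both by (simp only: int_binomial_Suc_right p)
  also have "\<dots> = ((int p)\<^sup>2 - (int m + 1)\<^sup>2) * (int ((p - 1) choose m) * int ((p + m) choose m))"
    by (simp add: power2_eq_square algebra_simps)
  also have "[\<dots> = (0 - (int m + 1)\<^sup>2) * (-1) ^ m] (mod (int p)\<^sup>2)"
    using Suc by (intro cong_mult cong_diff cong_refl) (auto simp: cong_0_iff)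
  also have "(0 - (int m + 1)\<^sup>2) * (-1) ^ m = (int m + 1)\<^sup>2 * (-1) ^ Suc m" by simp
  finally show ?case using cop by (simp only: cong_mult_lcancel)
qed simp

text \<open>\<open>b k j\<close> depends on \<open>k\<close> only through \<open>k * (k + 1)\<close>, which is invariant under \<open>k \<mapsto> -1 - k\<close>.\<close>
lemma cong_apery_binomial_reflect:
  assumes "prime p" "k < p" "j < p"
  shows "[apery_binomial k j = apery_binomial (p - 1 - k) j] (mod int p)"
  using \<open>j < p\<close>
proof (induction j)
  case (Suc j)
  define N where "N = p - 1 - k"
  have N: "int N = int p - 1 - int k" using assms by (simp add: N_def)
  have cop: "coprime ((int j + 1)\<^sup>2) (int p)"
    using coprime_int_prime[OF \<open>prime p\<close>, of "Suc j"] Suc.prems by (simp add: add.commute)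
  have "(int k - int j) * (int k + int j + 1) - (int N - int j) * (int N + int j + 1) =
      int p * (2 * int k + 1 - int p)"
    by (simp add: N algebra_simps)
  then have "[(int k - int j) * (int k + int j + 1) = (int N - int j) * (int N + int j + 1)] (mod int p)"
    by (simp add: cong_iff_dvd_diff)
  then have "[(int j + 1)\<^sup>2 * apery_binomial k (Suc j) = (int j + 1)\<^sup>2 * apery_binomial N (Suc j)] (mod int p)"
    unfolding apery_binomial_Suc
    by (rule cong_mult) (use Suc in \<open>simp add: N_def\<close>)
  then show ?case using cop by (simp only: cong_mult_lcancel N_def)
qed simp

text \<open>\<open>p\<close> divides \<open>(2i)!\<close> but not \<open>i!\<close>.\<close>

lemma prime_dvd_central_binomial:
  assumes "prime p" "i < p" "p \<le> 2 * i"
  shows "p dvd ((2 * i) choose i)"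
proof -
  have "p dvd fact i * fact i * ((2 * i) choose i)"
    using binomial_fact_lemma[of i "2 * i"] assms by (simp add: prime_dvd_fact_iff)
  then show ?thesis
    using assms by (auto simp: prime_dvd_mult_iff prime_dvd_fact_iff)
qed

text \<open>The inner sum over \<open>j\<close> acts as 1 in every term. For
  \<open>2 * i < p\<close> it is a full alternating sum. Otherwise the central binomial supplies one
  factor \<open>p\<close>, so the inner sum matters only modulo \<open>p\<close>, and there
  reflection completes it.\<close>

lemma cong_apery_quot:
  assumes "prime p" "odd p"
  shows "[apery_quot p x = (\<Sum>i<p. int ((2 * i) choose i) * x ^ i)] (mod (int p)\<^sup>2)"
proof -
  \<comment> \<open>The cut at \<open>i + j < p\<close> reflects the vanishing of
    \<open>(p - 1) choose (i + j)\<close> beyond it.\<close>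
  define T where "T i = (\<Sum>j\<le>i. if i + j < p then (-1) ^ (i + j) * apery_binomial i j else 0)" for i
  have term_cong: "[int ((2 * i) choose i) * x ^ i * (\<Sum>j\<le>i. apery_binomial i j *
      (int ((p - 1) choose (i + j)) * int ((p + (i + j)) choose (i + j)))) =
      int ((2 * i) choose i) * x ^ i] (mod (int p)\<^sup>2)" if "i < p" for i
  proof -
    have "[(\<Sum>j\<le>i. apery_binomial i j * (int ((p - 1) choose (i + j)) * int ((p + (i + j)) choose (i + j)))) = T i]
      (mod (int p)\<^sup>2)"
      unfolding T_def
    proof (rule cong_sum)
      fix j
      show "[apery_binomial i j * (int ((p - 1) choose (i + j)) * int ((p + (i + j)) choose (i + j))) =
        (if i + j < p then (-1) ^ (i + j) * apery_binomial i j else 0)] (mod (int p)\<^sup>2)"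
      proof (cases "i + j < p")
        case True
        have "[apery_binomial i j * (int ((p - 1) choose (i + j)) * int ((p + (i + j)) choose (i + j))) =
          apery_binomial i j * (-1) ^ (i + j)] (mod (int p)\<^sup>2)"
          by (intro cong_mult cong_refl cong_choose_prime_mult assms True)
        with True show ?thesis by (simp only: if_True mult.commute)
      next
        case False
        with that have "p - 1 < i + j" by simp
        with False show ?thesis by (simp add: binomial_eq_0)
      qed
    qed
    moreover have "[int ((2 * i) choose i) * T i = int ((2 * i) choose i) * 1] (mod (int p)\<^sup>2)"
    proof (cases "2 * i < p")
      case True
      have "T i = (\<Sum>j\<le>i. (-1) ^ i * ((-1) ^ j * apery_binomial i j))"
        unfolding T_def using True by (intro sum.cong) (auto simp: power_add)
      also have "\<dots> = 1"
        unfolding sum_distrib_left[symmetric] alternating_sum_apery_binomial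
        by (simp add: power_add[symmetric])
      finally show ?thesis by simp
    next
      case False
      \<comment> \<open>The cut falls at \<open>j = p - 1 - i\<close>, which is exactly the
        reflected index, so the truncated sum for \<open>i\<close> becomes the full sum for
        \<open>N\<close>.\<close>
      define N where "N = p - 1 - i"
      have "N \<le> i" "i + N = p - 1" using False that by (auto simp: N_def)
      have "T i = (\<Sum>j\<le>N. (-1) ^ (i + j) * apery_binomial i j)"
        unfolding T_def using \<open>N \<le> i\<close> that
        by (intro sum.mono_neutral_cong_right) (auto simp: N_def)
      also have "[\<dots> = (\<Sum>j\<le>N. (-1) ^ (i + j) * apery_binomial N j)] (mod int p)"
        unfolding N_def using that assms
        by (intro cong_sum cong_mult cong_refl cong_apery_binomial_reflect) auto
      also have "(\<Sum>j\<le>N. (-1) ^ (i + j) * apery_binomial N j) = (-1) ^ i * (\<Sum>j\<le>N. (-1) ^ j * apery_binomial N j)"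
        by (simp only: power_add sum_distrib_left mult.assoc)
      also have "\<dots> = (-1) ^ (p - 1)"
        unfolding alternating_sum_apery_binomial \<open>i + N = p - 1\<close>[symmetric] by (simp only: power_add)
      also have "\<dots> = 1" using assms by simp
      finally have "int p dvd T i - 1" by (simp add: cong_iff_dvd_diff)
      moreover have "int p dvd int ((2 * i) choose i)"
        using prime_dvd_central_binomial[of p i] that False assms by simp
      ultimately have "int p * int p dvd int ((2 * i) choose i) * (T i - 1)" by (intro mult_dvd_mono)
      then show ?thesis by (simp add: cong_iff_dvd_diff power2_eq_square algebra_simps)
    qed
    ultimately have "[int ((2 * i) choose i) * (\<Sum>j\<le>i. apery_binomial i j *
      (int ((p - 1) choose (i + j)) * int ((p + (i + j)) choose (i + j)))) = int ((2 * i) choose i) * 1] (mod (int p)\<^sup>2)"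
      using cong_trans cong_scalar_left by blast
    from cong_scalar_left[OF this, of "x ^ i"] show ?thesis by (simp only: mult_ac mult_1_right mult_1_left)
  qed
  have "- ((-1) ^ p) = (1 :: int)" using assms by simp
  then show ?thesis
    unfolding apery_quot_def by (simp only: mult_1_left) (intro cong_sum term_cong, auto)
qed

section \<open>Sums of central binomials: reduction modulo \<open>p\<close> and a recurrence\<close>

lemma central_binomial_Suc:
  "(int k + 1) * int ((2 * Suc k) choose Suc k) = 2 * (2 * int k + 1) * int ((2 * k) choose k)"
proof -
  have 1: "(int k + 1) * int ((2 * Suc k) choose Suc k) = 2 * (int k + 1) * int (Suc (2 * k) choose k)"
    using int_binomial_Suc_both[of k "Suc (2 * k)"] by (simp add: algebra_simps del: binomial_Suc_Suc)
  have "(int k + 1) * int (Suc (2 * k) choose k) = (2 * int k + 1) * int ((2 * k) choose k)"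
    using int_binomial_Suc_left[of "2 * k" k] by (simp add: algebra_simps del: binomial_Suc_Suc)
  with 1 show ?thesis by (simp only: mult.assoc)
qed

text \<open>\<open>(2k choose k) = (-1/2 choose k) * (-4)^k\<close>, and \<open>-1/2\<close> is
  congruent to \<open>(p - 1) / 2\<close> modulo \<open>p\<close>.\<close>

lemma cong_central_binomial:
  assumes "prime p" "odd p" "k < p"
  shows "[int ((2 * k) choose k) = int (((p - 1) div 2) choose k) * (-4) ^ k] (mod int p)"
  using \<open>k < p\<close>
proof (induction k)
  case (Suc k)
  define h where "h = (p - 1) div 2"
  have h: "2 * int h = int p - 1" using assms(2) by (auto simp: h_def elim!: oddE)
  have cop: "coprime (int k + 1) (int p)"
    using coprime_int_prime[OF \<open>prime p\<close>, of "Suc k"] Suc.prems by (simp add: add.commute)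
  have IH: "[int ((2 * k) choose k) = int (h choose k) * (-4) ^ k] (mod int p)"
    using Suc by (simp add: h_def)
  have "2 * (2 * int k + 1) - (int h - int k) * (-4) = 2 * int p"
    using h by (simp add: algebra_simps)
  then have *: "[2 * (2 * int k + 1) = (int h - int k) * (-4)] (mod int p)"
    unfolding cong_iff_dvd_diff by simp
  have "[(int k + 1) * int ((2 * Suc k) choose Suc k) = (int h - int k) * (-4) * (int (h choose k) * (-4) ^ k)] (mod int p)"
    unfolding central_binomial_Suc by (intro cong_mult * IH)
  also have "(int h - int k) * (-4) * (int (h choose k) * (-4) ^ k) =
      (int k + 1) * (int (h choose Suc k) * (-4) ^ Suc k)"
    using arg_cong[OF int_binomial_Suc_right[of k h], of "\<lambda>z. z * (-4) ^ Suc k"]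
    by (simp only: power_Suc mult_ac)
  finally show ?case using cop by (simp only: cong_mult_lcancel h_def)
qed simp

text \<open>The binomial theorem collapses the sum to a power, which Euler's criterion
  identifies.\<close>

lemma cong_sum_central_binomial_Legendre:
  assumes "prime p" "odd p"
  shows "[(\<Sum>i<p. int ((2 * i) choose i) * x ^ i) = Legendre (1 - 4 * x) (int p)] (mod int p)"
proof -
  define h where "h = (p - 1) div 2"
  have "p > 2" using assms prime_ge_2_nat[of p] by (cases "p = 2") auto
  have "[(\<Sum>i<p. int ((2 * i) choose i) * x ^ i) = (\<Sum>i<p. int (h choose i) * (-4) ^ i * x ^ i)] (mod int p)"
    unfolding h_def by (intro cong_sum cong_mult cong_refl cong_central_binomial assms) auto
  also have "(\<Sum>i<p. int (h choose i) * (-4) ^ i * x ^ i) = (\<Sum>i\<le>h. int (h choose i) * (-4) ^ i * x ^ i)"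
    using \<open>p > 2\<close> by (intro sum.mono_neutral_right) (auto simp: h_def)
  also have "\<dots> = (- 4 * x + 1) ^ h"
    unfolding binomial_ring by (simp only: power_mult_distrib mult.assoc power_one mult_1_right)
  also have "\<dots> = (1 - 4 * x) ^ ((p - 1) div 2)" by (simp add: h_def)
  also have "[\<dots> = Legendre (1 - 4 * x) (int p)] (mod int p)"
    using euler_criterion[OF assms(1) \<open>p > 2\<close>] by (rule cong_sym)
  finally show ?thesis .
qed

text \<open>
  Extended to an odd function on the integers, \<open>g\<close> satisfies \<open>(E + 2 + 1/E) g = m * g\<close> for the shift \<open>E\<close>,
  and the \<open>2n choose n + j\<close> are the coefficients of \<open>(E + 2 + 1/E)^n\<close>.
\<close>
lemma sum_central_binomial_recurrence:
  fixes g :: "nat \<Rightarrow> 'a :: comm_ring_1"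
  assumes g0: "g 0 = 0" and rec: "\<And>j. g (j + 2) + 2 * g (j + 1) + g j = m * g (j + 1)"
  shows "(\<Sum>k<n. of_nat ((2 * k) choose k) * m ^ (n - Suc k)) * g 1 =
    (\<Sum>j\<le>n. of_nat ((2 * n) choose (n + j)) * g j)"
proof (induction n)
  case (Suc n)
  define c :: "nat \<Rightarrow> 'a" where "c j = of_nat ((2 * n) choose (n + j))" for j
  have c0: "c j = 0" if "j > n" for j using that by (simp add: c_def binomial_eq_0)
  have shift: "sum f {..n} = f 0 + (\<Sum>i\<le>n. f (Suc i))" if "f (Suc n) = 0" for f :: "nat \<Rightarrow> 'a"
    using sum.atMost_Suc_shift[of f n] that by simp
  \<comment> \<open>Pascal's rule applied twice.\<close>
  have c2: "of_nat ((2 * Suc n) choose (Suc n + Suc i)) = c i + 2 * c (Suc i) + c (Suc (Suc i))" for i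
    by (simp add: c_def algebra_simps)
  have "(\<Sum>j\<le>Suc n. of_nat ((2 * Suc n) choose (Suc n + j)) * g j) =
      (\<Sum>i\<le>n. (c i + 2 * c (Suc i) + c (Suc (Suc i))) * g (Suc i))"
    unfolding sum.atMost_Suc_shift c2 by (simp add: g0)
  also have "\<dots> = (\<Sum>i\<le>n. c i * g (Suc i)) + 2 * (\<Sum>i\<le>n. c (Suc i) * g (Suc i))
      + (\<Sum>i\<le>n. c (Suc (Suc i)) * g (Suc i))"
    by (simp only: sum_distrib_left sum.distrib[symmetric] distrib_right mult.assoc)
  \<comment> \<open>Shifting the indices leaves only the boundary term \<open>c 0 * g 1\<close>,
    which is the new summand \<open>k = n\<close>; the other ends vanish by \<open>c0\<close> and
    \<open>g0\<close>.\<close>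
  also have "(\<Sum>i\<le>n. c i * g (Suc i)) = c 0 * g 1 + (\<Sum>i\<le>n. c (Suc i) * g (Suc (Suc i)))"
    by (subst shift) (simp_all add: c0)
  also have "(\<Sum>i\<le>n. c (Suc (Suc i)) * g (Suc i)) = (\<Sum>i\<le>n. c (Suc i) * g i)"
    by (subst (2) shift) (simp_all add: c0 g0)
  also have "c 0 * g 1 + (\<Sum>i\<le>n. c (Suc i) * g (Suc (Suc i))) + 2 * (\<Sum>i\<le>n. c (Suc i) * g (Suc i))
      + (\<Sum>i\<le>n. c (Suc i) * g i) = c 0 * g 1 + (\<Sum>i\<le>n. c (Suc i) * (g (i + 2) + 2 * g (i + 1) + g i))"
    by (simp add: sum_distrib_left sum.distrib algebra_simps)
  also have "(\<Sum>i\<le>n. c (Suc i) * (g (i + 2) + 2 * g (i + 1) + g i)) = m * (\<Sum>i\<le>n. c (Suc i) * g (Suc i))"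
    unfolding rec by (simp add: sum_distrib_left mult_ac)
  also have "(\<Sum>i\<le>n. c (Suc i) * g (Suc i)) = (\<Sum>i\<le>n. c i * g i)"
    by (subst (2) shift) (simp_all add: c0 g0)
  also have "\<dots> = (\<Sum>k<n. of_nat ((2 * k) choose k) * m ^ (n - Suc k)) * g 1"
    unfolding Suc.IH c_def ..
  also have "c 0 * g 1 + m * \<dots> = (\<Sum>k<Suc n. of_nat ((2 * k) choose k) * m ^ (Suc n - Suc k)) * g 1"
  proof -
    have "m * (\<Sum>k<n. of_nat ((2 * k) choose k) * m ^ (n - Suc k)) =
      (\<Sum>k<n. of_nat ((2 * k) choose k) * m ^ (Suc n - Suc k))"
      unfolding sum_distrib_left
    proof (rule sum.cong)
      fix k assume "k \<in> {..<n}"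
      then have "Suc n - Suc k = Suc (n - Suc k)" by auto
      then show "m * (of_nat ((2 * k) choose k) * m ^ (n - Suc k)) = of_nat ((2 * k) choose k) * m ^ (Suc n - Suc k)"
        by (simp only: power_Suc mult_ac)
    qed simp
    then have "m * ((\<Sum>k<n. of_nat ((2 * k) choose k) * m ^ (n - Suc k)) * g 1) =
        (\<Sum>k<n. of_nat ((2 * k) choose k) * m ^ (Suc n - Suc k)) * g 1"
      by (simp only: mult.assoc[symmetric])
    then show ?thesis by (simp add: c_def distrib_right add.commute)
  qed
  finally show ?case by (rule sym)
qed (simp add: g0)

section \<open>The binomials \<open>2p choose p + j\<close> modulo \<open>p^2\<close>\<close>

text \<open>In Vandermonde's convolution for \<open>(p + p) choose (p - j)\<close> the two end terms
  are equal, and every interior product contains \<open>p\<close> twice.\<close>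

lemma cong_choose_2p:
  assumes "prime p" "0 < j" "j < p"
  shows "[int ((2 * p) choose (p + j)) = 2 * int (p choose j)] (mod (int p)\<^sup>2)"
proof -
  define k where "k = p - j"
  have k: "0 < k" "k < p" using assms by (auto simp: k_def)
  have "(2 * p) choose (p + j) = (p + p) choose k"
    using binomial_symmetric[of "p + j" "2 * p"] assms by (simp add: k_def mult_2)
  also have "\<dots> = (\<Sum>i\<le>k. (p choose i) * (p choose (k - i)))"
    by (rule vandermonde[symmetric])
  also have "{..k} = insert 0 (insert k {0<..<k})" using k by auto
  also have "(\<Sum>i\<in>insert 0 (insert k {0<..<k}). (p choose i) * (p choose (k - i)))
      = 2 * (p choose k) + (\<Sum>i\<in>{0<..<k}. (p choose i) * (p choose (k - i)))"
    using k by simp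
  also have "p choose k = p choose j"
    using binomial_symmetric[of j p] assms by (simp add: k_def)
  finally have eq: "(2 * p) choose (p + j) =
      2 * (p choose j) + (\<Sum>i\<in>{0<..<k}. (p choose i) * (p choose (k - i)))" .
  have "p * p dvd (\<Sum>i\<in>{0<..<k}. (p choose i) * (p choose (k - i)))"
    using k assms by (intro dvd_sum mult_dvd_mono dvd_choose_prime) auto
  then have "int (p * p) dvd int (\<Sum>i\<in>{0<..<k}. (p choose i) * (p choose (k - i)))"
    by (simp only: int_dvd_int_iff)
  then show ?thesis
    unfolding eq by (simp add: cong_iff_dvd_diff power2_eq_square)
qed

text \<open>The term \<open>j = p\<close> stands apart because its coefficient
  \<open>2p choose 2p\<close> is 1 and not 2.\<close>

lemma cong_sum_choose_2p:
  fixes f :: "nat \<Rightarrow> int"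
  assumes "prime p" "f 0 = 0"
  shows "[(\<Sum>j\<le>p. int ((2 * p) choose (p + j)) * f j) =
    f p + 2 * (\<Sum>j\<in>{0<..<p}. int (p choose j) * f j)] (mod (int p)\<^sup>2)"
proof -
  have "p > 0" using assms by (simp add: prime_gt_0_nat)
  then have "{..p} = insert 0 (insert p {0<..<p})" by auto
  with \<open>p > 0\<close> have "(\<Sum>j\<le>p. int ((2 * p) choose (p + j)) * f j) =
      f p + (\<Sum>j\<in>{0<..<p}. int ((2 * p) choose (p + j)) * f j)"
    by (simp add: assms(2) mult_2[symmetric])
  also have "[\<dots> = f p + (\<Sum>j\<in>{0<..<p}. 2 * int (p choose j) * f j)] (mod (int p)\<^sup>2)"
    using assms by (intro cong_add cong_sum cong_mult cong_refl cong_choose_2p) auto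
  also have "(\<Sum>j\<in>{0<..<p}. 2 * int (p choose j) * f j) = 2 * (\<Sum>j\<in>{0<..<p}. int (p choose j) * f j)"
    by (simp only: sum_distrib_left mult.assoc)
  finally show ?thesis .
qed

section \<open>The case \<open>x = 1\<close>: the character modulo 3\<close>

text \<open>The nonprincipal character modulo 3, which solves the second-order recurrence for
  \<open>m = 1\<close> with initial values 0 and 1.\<close>

definition char3 :: "nat \<Rightarrow> int" where
  "char3 j = (if j mod 3 = 0 then 0 else if j mod 3 = 1 then 1 else -1)"

lemma char3_recurrence: "char3 (j + 2) + char3 (j + 1) + char3 j = 0"
proof -
  have "j mod 3 = 0 \<or> j mod 3 = 1 \<or> j mod 3 = 2" by linarith
  then show ?thesis by (elim disjE) (simp_all add: char3_def mod_Suc)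
qed

lemma char3_double: "char3 (2 * j) = - char3 j"
proof -
  have "(2 * j) mod 3 = (2 * (j mod 3)) mod 3" by (simp only: mod_mult_right_eq)
  moreover have "j mod 3 = 0 \<or> j mod 3 = 1 \<or> j mod 3 = 2" by linarith
  ultimately show ?thesis by (elim disjE) (simp_all add: char3_def)
qed

text \<open>\<open>char3\<close> is a linear combination of powers of the primitive cube roots of
  unity \<open>w\<close>, and \<open>1 + w = - w^2\<close>. The offset \<open>a\<close> is what the
  induction generalizes over.\<close>

lemma sum_choose_char3: "(\<Sum>k\<le>n. int (n choose k) * char3 (k + a)) = (-1) ^ n * char3 (2 * n + a)"
proof (induction n arbitrary: a)
  case (Suc n)
  have "(\<Sum>k\<le>Suc n. int (Suc n choose k) * char3 (k + a)) =
      (char3 a + (\<Sum>k\<le>n. int (n choose Suc k) * char3 (Suc k + a))) +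
      (\<Sum>k\<le>n. int (n choose k) * char3 (k + Suc a))"
    unfolding sum.atMost_Suc_shift by (simp add: distrib_right sum.distrib)
  also have "char3 a + (\<Sum>k\<le>n. int (n choose Suc k) * char3 (Suc k + a)) =
      (\<Sum>k\<le>Suc n. int (n choose k) * char3 (k + a))"
    unfolding sum.atMost_Suc_shift by simp
  also have "\<dots> = (\<Sum>k\<le>n. int (n choose k) * char3 (k + a))" by simp
  finally have "(\<Sum>k\<le>Suc n. int (Suc n choose k) * char3 (k + a)) =
      (-1) ^ n * (char3 (2 * n + a) + char3 (2 * n + a + 1))"
    unfolding Suc.IH by (simp add: algebra_simps)
  also have "char3 (2 * n + a) + char3 (2 * n + a + 1) = - char3 (2 * Suc n + a)"
    using char3_recurrence[of "2 * n + a"] by (simp add: algebra_simps)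
  finally show ?case by simp
qed simp

lemma Legendre_3_eq_char3: "Legendre (int p) 3 = char3 p"
proof -
  have "int p mod 3 = int (p mod 3)" by (simp add: zmod_int)
  moreover have "p mod 3 = 0 \<or> p mod 3 = 1 \<or> p mod 3 = 2" by presburger
  moreover have "QuadRes 3 (int p)" if "int p mod 3 = 1"
    unfolding QuadRes_def by (rule exI[of _ 1]) (simp add: cong_def that)
  moreover have "\<not> QuadRes 3 (int p)" if p2: "int p mod 3 = 2"
  proof
    assume "QuadRes 3 (int p)"
    then obtain y :: int where y: "y ^ 2 mod 3 = 2" by (auto simp: QuadRes_def cong_def p2)
    have "y mod 3 = 0 \<or> y mod 3 = 1 \<or> y mod 3 = 2" by presburger
    then have "(y mod 3) ^ 2 mod 3 \<noteq> 2" by auto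
    with y show False by (simp add: power_mod)
  qed
  ultimately show ?thesis by (auto simp: Legendre_def char3_def cong_def)
qed

lemma cong_sum_central_binomial:
  assumes "prime p" "odd p"
  shows "[(\<Sum>k<p. int ((2 * k) choose k)) = Legendre (int p) 3] (mod (int p)\<^sup>2)"
proof -
  have "(\<Sum>k<p. int ((2 * k) choose k)) = (\<Sum>j\<le>p. int ((2 * p) choose (p + j)) * char3 j)"
    using sum_central_binomial_recurrence[of char3 1 p] char3_recurrence
    by (simp add: char3_def[of 0] char3_def[of "Suc 0"] algebra_simps)
  also have "[\<dots> = char3 p + 2 * (\<Sum>j\<in>{0<..<p}. int (p choose j) * char3 j)] (mod (int p)\<^sup>2)"
    using assms by (intro cong_sum_choose_2p) (auto simp: char3_def)
  \<comment> \<open>For odd \<open>p\<close> the full binomial sum is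
    \<open>- char3 (2 * p) = char3 p\<close>, which its end term \<open>j = p\<close> already
    accounts for.\<close>
  also have "(\<Sum>j\<in>{0<..<p}. int (p choose j) * char3 j) = 0"
  proof -
    have "p > 0" using assms by (simp add: prime_gt_0_nat)
    then have "{..p} = insert 0 (insert p {0<..<p})" by auto
    then have "(\<Sum>j\<le>p. int (p choose j) * char3 j) =
        char3 0 + char3 p + (\<Sum>j\<in>{0<..<p}. int (p choose j) * char3 j)"
      using \<open>p > 0\<close> by simp
    then show ?thesis
      using sum_choose_char3[of p 0] char3_double[of p] assms by (simp add: char3_def[of 0])
  qed
  finally show ?thesis by (simp add: Legendre_3_eq_char3)
qed

section \<open>The case \<open>x = -2\<close>\<close>

text \<open>The recurrence is used over the rationals with \<open>m = 1/x\<close>; multiplying by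
  \<open>(-2)^n\<close> clears all denominators.\<close>

lemma sum_central_binomial_minus_2:
  "- 3 * (\<Sum>k<n. int ((2 * k) choose k) * (-2) ^ k) =
    (\<Sum>j\<le>n. int ((2 * n) choose (n + j)) * ((-2) ^ (n - j) - (-2) ^ (n + j)))"
proof -
  \<comment> \<open>\<open>-1/2\<close> and \<open>-2\<close> are the roots of \<open>t\<^sup>2 + 2 * t + 1 = m * t\<close> for \<open>m = -1/2\<close>\<close>
  define g :: "nat \<Rightarrow> rat" where "g j = (-1/2) ^ j - (-2) ^ j" for j
  have scale: "(-2) ^ n * (-1/2 :: rat) ^ i = (-2) ^ (n - i)" if "i \<le> n" for i
  proof -
    have "(-2 :: rat) ^ n = (-2) ^ (n - i) * (-2) ^ i"
      using that by (simp only: power_add[symmetric] le_add_diff_inverse2)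
    moreover have "(-2 :: rat) ^ i * (-1/2) ^ i = 1"
      unfolding power_mult_distrib[symmetric] by simp
    ultimately show ?thesis by simp
  qed
  have "(-2) ^ n * ((\<Sum>k<n. of_nat ((2 * k) choose k) * (-1/2) ^ (n - Suc k)) * g 1) =
      (-2) ^ n * (\<Sum>j\<le>n. of_nat ((2 * n) choose (n + j)) * g j)"
    by (subst sum_central_binomial_recurrence) (simp_all add: g_def field_simps)
  also have "\<dots> = (\<Sum>j\<le>n. of_nat ((2 * n) choose (n + j)) * ((-2) ^ n * (-1/2) ^ j - (-2) ^ (n + j)))"
    by (simp only: sum_distrib_left g_def right_diff_distrib power_add mult_ac)
  also have "\<dots> = (\<Sum>j\<le>n. of_nat ((2 * n) choose (n + j)) * ((-2) ^ (n - j) - (-2) ^ (n + j)))"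
    by (intro sum.cong) (simp_all only: scale atMost_iff)
  also have "(-2) ^ n * ((\<Sum>k<n. of_nat ((2 * k) choose k) * (-1/2) ^ (n - Suc k)) * g 1) =
      (\<Sum>k<n. of_nat ((2 * k) choose k) * ((-2) ^ n * (-1/2) ^ (n - Suc k))) * g 1"
    by (simp only: sum_distrib_left mult_ac)
  also have "(\<Sum>k<n. of_nat ((2 * k) choose k) * ((-2) ^ n * (-1/2) ^ (n - Suc k))) =
      (\<Sum>k<n. of_nat ((2 * k) choose k) * (-2 :: rat) ^ Suc k)"
  proof (rule sum.cong)
    fix k assume "k \<in> {..<n}"
    then have "n - (n - Suc k) = Suc k" by auto
    then show "of_nat ((2 * k) choose k) * ((-2) ^ n * (-1/2) ^ (n - Suc k)) =
        of_nat ((2 * k) choose k) * (-2 :: rat) ^ Suc k"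
      by (subst scale) simp_all
  qed simp
  \<comment> \<open>Here \<open>g 1 = 3/2\<close>, and the surplus factor -2 in
    \<open>(-2) ^ Suc k\<close> turns it into -3.\<close>
  also have "\<dots> * g 1 = - 3 * (\<Sum>k<n. of_nat ((2 * k) choose k) * (-2) ^ k)"
    by (simp add: g_def sum_distrib_left sum_distrib_right)
  finally have "rat_of_int (- 3 * (\<Sum>k<n. int ((2 * k) choose k) * (-2) ^ k)) =
    rat_of_int (\<Sum>j\<le>n. int ((2 * n) choose (n + j)) * ((-2) ^ (n - j) - (-2) ^ (n + j)))"
    by simp
  then show ?thesis by (simp only: of_int_eq_iff)
qed

lemma cong_sum_central_binomial_minus_2:
  assumes "prime p" "odd p"
  shows "[3 * (\<Sum>k<p. int ((2 * k) choose k) * (-2) ^ k) = 3 - 4 * (2 ^ (p - 1) - 1)] (mod (int p)\<^sup>2)"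
proof -
  \<comment> \<open>By Fermat \<open>p\<close> divides \<open>q\<close>, so everything is expanded
    in \<open>q\<close> and \<open>q^2\<close> is dropped at the end.\<close>
  define q :: int where "q = 2 ^ (p - 1) - 1"
  have "p > 0" using assms by (simp add: prime_gt_0_nat)
  have "(2::int) ^ p = 2 * 2 ^ (p - 1)" using \<open>p > 0\<close> by (metis power_Suc Suc_pred' )
  then have pow: "(-2::int) ^ p = - (2 * (q + 1))" using assms by (simp add: q_def)
  have "[2 ^ (p - 1) = (1::nat)] (mod p)"
  proof (rule fermat_theorem)
    show "\<not> p dvd 2" using assms by (metis dvd_imp_le odd_one dvd_refl le_less_trans
      less_antisym numeral_2_eq_2 pos2 prime_ge_2_nat antisym)
  qed fact
  then have "[int (2 ^ (p - 1)) = int 1] (mod int p)" by (simp only: cong_int_iff)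
  then have "int p dvd q" by (simp add: q_def cong_iff_dvd_diff)
  then have "(int p)\<^sup>2 dvd q\<^sup>2" by (simp add: dvd_power_same)
  define f :: "nat \<Rightarrow> int" where "f j = (-2) ^ (p - j) - (-2) ^ (p + j)" for j
  have split: "(\<Sum>j\<le>p. h j) = h 0 + h p + (\<Sum>j\<in>{0<..<p}. h j)" for h :: "nat \<Rightarrow> int"
  proof -
    have "{..p} = insert 0 (insert p {0<..<p})" using \<open>p > 0\<close> by auto
    then show ?thesis using \<open>p > 0\<close> by simp
  qed
  have s1: "(\<Sum>j\<le>p. int (p choose j) * (-2) ^ j) = -1"
    using binomial_ring[of "-2 :: int" 1 p] assms by simp
  have s2: "(\<Sum>j\<le>p. int (p choose j) * (-2) ^ (p - j)) = -1"
    using binomial_ring[of 1 "-2 :: int" p] assms by simp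
  \<comment> \<open>The full sum is \<open>(1 - 2)^p = -1\<close>; removing the end terms 1 and
    \<open>(-2)^p = - 2 * (q + 1)\<close> leaves \<open>2 * q\<close>.\<close>
  have m1: "(\<Sum>j\<in>{0<..<p}. int (p choose j) * (-2) ^ j) = 2 * q"
    using s1 unfolding split by (simp add: pow)
  have m2: "(\<Sum>j\<in>{0<..<p}. int (p choose j) * (-2) ^ (p - j)) = 2 * q"
    using s2 unfolding split by (simp add: pow)
  have "(\<Sum>j\<in>{0<..<p}. int (p choose j) * f j) =
      (\<Sum>j\<in>{0<..<p}. int (p choose j) * (-2) ^ (p - j)) -
      (-2) ^ p * (\<Sum>j\<in>{0<..<p}. int (p choose j) * (-2) ^ j)"
    by (simp only: f_def sum_distrib_left sum_subtractf[symmetric] right_diff_distrib power_add mult_ac)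
  also have "\<dots> = 2 * q + 2 * (q + 1) * (2 * q)" unfolding m1 m2 pow
    by (simp only: mult_minus_left diff_minus_eq_add)
  finally have mid: "(\<Sum>j\<in>{0<..<p}. int (p choose j) * f j) = 2 * q + 2 * (q + 1) * (2 * q)" .
  have "f p = 1 - ((-2) ^ p)\<^sup>2" by (simp add: f_def power2_eq_square power_add)
  then have fp: "f p = 1 - (2 * (q + 1))\<^sup>2" unfolding pow by (simp only: power2_minus)
  have "[- 3 * (\<Sum>k<p. int ((2 * k) choose k) * (-2) ^ k) =
      f p + 2 * (\<Sum>j\<in>{0<..<p}. int (p choose j) * f j)] (mod (int p)\<^sup>2)"
    unfolding sum_central_binomial_minus_2 f_def[symmetric]
    using assms by (intro cong_sum_choose_2p) (auto simp: f_def)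
  also have "f p + 2 * (\<Sum>j\<in>{0<..<p}. int (p choose j) * f j) = 4 * q\<^sup>2 - (3 - 4 * q)"
    unfolding mid fp by (simp add: power2_eq_square algebra_simps)
  also have "[\<dots> = 0 - (3 - 4 * q)] (mod (int p)\<^sup>2)"
    using \<open>(int p)\<^sup>2 dvd q\<^sup>2\<close> by (intro cong_diff cong_refl) (simp add: cong_0_iff)
  finally have "[- (3 * (\<Sum>k<p. int ((2 * k) choose k) * (-2) ^ k)) = - (3 - 4 * q)] (mod (int p)\<^sup>2)"
    by simp
  then show ?thesis by (simp only: cong_minus_minus_iff q_def)
qed

section \<open>Congruences of rationals\<close>

text \<open>Links the lowest terms used by \<open>rat_cong\<close> to an arbitrary representation
  \<open>c / d\<close>.\<close>

lemma quotient_of_quotient: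
  assumes "q = of_int c / of_int d" "d \<noteq> 0" "quotient_of q = (a, b)"
  shows "a * d = c * b" "b dvd d"
proof -
  have "b \<noteq> 0" using quotient_of_denom_pos[OF assms(3)] by simp
  have "rat_of_int c / of_int d = of_int a / of_int b"
    using quotient_of_div[OF assms(3)] assms(1) by simp
  then have "rat_of_int (a * d) = rat_of_int (c * b)"
    using \<open>b \<noteq> 0\<close> \<open>d \<noteq> 0\<close> by (simp add: field_simps)
  then show "a * d = c * b" by (simp only: of_int_eq_iff)
  then have "b dvd a * d" by simp
  then show "b dvd d"
    using quotient_of_coprime[OF assms(3)] by (simp add: coprime_dvd_mult_right_iff coprime_commute)
qed

text \<open>Clearing the denominator \<open>d\<close>, which is invertible modulo \<open>m\<close>,
  reduces the claim to a congruence of integers.\<close>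

lemma rat_cong_of_int_divide:
  assumes "coprime d m" "d \<noteq> 0" "[d * z = c] (mod m)"
  shows "rat_cong (of_int z) (of_int c / of_int d) m"
proof -
  obtain a b where q: "quotient_of (rat_of_int c / of_int d) = (a, b)" by fastforce
  obtain a' b' where q': "quotient_of (of_int z - rat_of_int c / of_int d) = (a', b')" by fastforce
  have "of_int z - rat_of_int c / of_int d = of_int (d * z - c) / of_int d"
    using assms(2) by (simp add: field_simps)
  from quotient_of_quotient(1)[OF this assms(2) q'] have "a' * d = (d * z - c) * b'" .
  then have "m dvd a' * d" using assms(3) by (simp add: cong_iff_dvd_diff)
  then have "m dvd a'" using assms(1) by (simp add: coprime_dvd_mult_left_iff coprime_commute)
  moreover have "coprime b m"
    by (rule coprime_divisors[OF quotient_of_quotient(2)[OF refl assms(2) q] dvd_refl assms(1)])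
  ultimately show ?thesis by (simp add: rat_cong_def q q')
qed

lemma rat_cong_of_int: "[z = c] (mod m) \<Longrightarrow> rat_cong (of_int z) (of_int c) m"
  using rat_cong_of_int_divide[of 1 m z c] by simp

theorem theorem1p1:
  fixes x :: int
  shows
    "(\<forall>n::nat. n > 0 \<longrightarrow>
        [(\<Sum>k=0..n-1. (-1) ^ k * (2 * int k + 1) * poly (apery_poly k) x) = 0] (mod (int n))) \<and>
     (\<forall>p::nat. prime p \<and> odd p \<longrightarrow>
        rat_cong
          (1 / of_nat p * of_int (\<Sum>k=0..p-1. (-1) ^ k * (2 * int k + 1) * poly (apery_poly k) x))
          (of_int (Legendre (1 - 4 * x) (int p)))
          (int p)) \<and>
     (\<forall>p::nat. prime p \<and> p > 3 \<longrightarrow>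
        rat_cong
          (1 / of_nat p * of_int (\<Sum>k=0..p-1. (-1) ^ k * (2 * int k + 1) * apery k))
          (of_int (Legendre (int p) 3))
          ((int p)\<^sup>2) \<and>
        rat_cong
          (1 / of_nat p * of_int (\<Sum>k=0..p-1. (-1) ^ k * (2 * int k + 1) * poly (apery_poly k) (-2)))
          (1 - 4 / 3 * (2 ^ (p - 1) - 1))
          ((int p)\<^sup>2))"
proof -
  have sum: "(\<Sum>k=0..n-1. (-1) ^ k * (2 * int k + 1) * poly (apery_poly k) y) = int n * apery_quot n y"
    if "n > 0" for n y
  proof -
    \<comment> \<open>Positivity matters: for \<open>n = 0\<close> truncated subtraction would make
      the left side \<open>{0}\<close>.\<close>
    from that have "{0..n-1} = {..<n}" by auto
    then show ?thesis by (simp only: sum_apery_poly)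
  qed
  have quot: "1 / of_nat p * of_int (\<Sum>k=0..p-1. (-1) ^ k * (2 * int k + 1) * poly (apery_poly k) y) =
      rat_of_int (apery_quot p y)" if "prime p" for p y
    using prime_gt_0_nat[OF that] by (simp only: sum) simp
  have odd: "odd p" if "prime p" "p > 3" for p :: nat
    using that prime_odd_nat[of p] by simp
  show ?thesis
  proof (intro conjI allI impI; (elim conjE)?)
    fix n :: nat assume "n > 0"
    then show "[(\<Sum>k=0..n-1. (-1) ^ k * (2 * int k + 1) * poly (apery_poly k) x) = 0] (mod (int n))"
      by (simp only: sum) (simp add: cong_0_iff)
  next
    fix p :: nat assume p: "prime p" "odd p"
    have "[apery_quot p x = (\<Sum>i<p. int ((2 * i) choose i) * x ^ i)] (mod int p)"
      using cong_apery_quot[OF p] by (rule cong_dvd_modulus) (simp add: power2_eq_square)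
    also have "[(\<Sum>i<p. int ((2 * i) choose i) * x ^ i) = Legendre (1 - 4 * x) (int p)] (mod int p)"
      using p by (rule cong_sum_central_binomial_Legendre)
    finally show "rat_cong
          (1 / of_nat p * of_int (\<Sum>k=0..p-1. (-1) ^ k * (2 * int k + 1) * poly (apery_poly k) x))
          (of_int (Legendre (1 - 4 * x) (int p)))
          (int p)"
      unfolding quot[OF p(1)] by (rule rat_cong_of_int)
  next
    fix p :: nat assume p: "prime p" "p > 3"
    have "[apery_quot p 1 = (\<Sum>i<p. int ((2 * i) choose i) * 1 ^ i)] (mod (int p)\<^sup>2)"
      using p by (intro cong_apery_quot odd)
    also have "(\<Sum>i<p. int ((2 * i) choose i) * 1 ^ i) = (\<Sum>i<p. int ((2 * i) choose i))" by simp
    also have "[\<dots> = Legendre (int p) 3] (mod (int p)\<^sup>2)"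
      using p by (intro cong_sum_central_binomial odd)
    finally show "rat_cong
          (1 / of_nat p * of_int (\<Sum>k=0..p-1. (-1) ^ k * (2 * int k + 1) * apery k))
          (of_int (Legendre (int p) 3))
          ((int p)\<^sup>2)"
      unfolding apery_def quot[OF p(1)] by (rule rat_cong_of_int)
  next
    fix p :: nat assume p: "prime p" "p > 3"
    \<comment> \<open>The factor 3 clears the denominator of \<open>4/3\<close>; it is coprime to
      \<open>p^2\<close> because \<open>p > 3\<close>.\<close>
    have "[3 * apery_quot p (-2) = 3 * (\<Sum>i<p. int ((2 * i) choose i) * (-2) ^ i)] (mod (int p)\<^sup>2)"
      using p by (intro cong_mult cong_refl cong_apery_quot odd)
    also have "[3 * (\<Sum>i<p. int ((2 * i) choose i) * (-2) ^ i) = 3 - 4 * (2 ^ (p - 1) - 1)] (mod (int p)\<^sup>2)"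
      using p by (intro cong_sum_central_binomial_minus_2 odd)
    finally have c: "[3 * apery_quot p (-2) = 3 - 4 * (2 ^ (p - 1) - 1)] (mod (int p)\<^sup>2)" .
    have "coprime 3 ((int p)\<^sup>2)"
      using coprime_int_prime[of p 3] p by simp
    from rat_cong_of_int_divide[OF this _ c]
    have "rat_cong (of_int (apery_quot p (-2))) (of_int (3 - 4 * (2 ^ (p - 1) - 1)) / of_int 3) ((int p)\<^sup>2)"
      by simp
    also have "rat_of_int (3 - 4 * (2 ^ (p - 1) - 1)) / of_int 3 = 1 - 4 / 3 * (2 ^ (p - 1) - 1)"
      by (simp add: field_simps)
    finally show "rat_cong
          (1 / of_nat p * of_int (\<Sum>k=0..p-1. (-1) ^ k * (2 * int k + 1) * poly (apery_poly k) (-2)))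
          (1 - 4 / 3 * (2 ^ (p - 1) - 1))
          ((int p)\<^sup>2)"
      unfolding quot[OF p(1)] .
  qed
qed

end
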